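(* Let $D_1=(V,A)$ be the digraph with vertex set $V=\{v_1,v_2,v_3,v_4\}$ and arc set $A=\{(v_2,v_1),(v_2,v_3),(v_4,v_1),(v_4,v_3)\}$ (where $v_1,v_2,v_3,v_4$ represent holomorphic, CR, anti-invariant and slant submanifolds of almost Hermitian manifolds, respectively). Then: (i) $D_1$ is a bipartite digraph, and moreover a complete bipartite digraph; (ii) $D_1$ has a perfect matching; (iii) the independence number of $D_1$ is $2$; (iv) the chromatic number of $D_1$ is $2$; (v) $D_1$ has no directed spanning tree; (vi) the domination number of $D_1$ is $2$.
   Context: An arc $(u,v)$ goes from $u$ to $v$. The geometric meaning of the vertices plays no role in the statement; the digraph is the explicit one given. Definitions for a digraph $D=(V,A)$: - $D$ is $p$-partite if $V$ can be partitioned into $p$ nonempty sets such that no arc joins two vertices of the same set; bipartite means $2$-partite. It is complete $p$-partite if, for such a partition, any two vertices lying in different sets are joined by an arc in some direction (i.e. the underlying undirected graph is complete $p$-partite). - A matching is a set of arcs, none a loop, no two of which share an end-vertex. A perfect matching is a matching with $|V|/2$ arcs. - A set of vertices is independent if there are no arcs between its members. The independence number is the maximum size of an independent set. The chromatic number is the minimum number of sets in a partition of $V$ into independent sets. - A directed spanning tree of $D$ with root $r\in V$ is a subdigraph $T$ of $D$ with $V(T)=V$ whose underlying undirected graph is a tree and in which there is a unique directed path from $r$ to each $v\in V\setminus\{r\}$. "$D$ has a directed spanning tree" means one exists for some root $r$. - A dominating set is a set $S\subseteq V$ such that for every $v\in V\setminus S$ there is $u\in S$ with $(u,v)\in A$.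 The domination number is the minimum cardinality of a dominating set. *)

theory Defs
  imports "Graph_Theory.Digraph_Component" "HOL-Library.Disjoint_Sets"
begin

text \<open>
  Digraphs are \<^typ>\<open>'a pair_pre_digraph\<close> records; all the notions below are meant for
  finite digraphs (in particular those involving \<^const>\<open>card\<close> or \<^const>\<open>Max\<close>).
\<close>

definition multipartition :: "'a pair_pre_digraph \<Rightarrow> nat \<Rightarrow> 'a set set \<Rightarrow> bool" where
  "multipartition D p P \<longleftrightarrow>
     partition_on (pverts D) P \<and> finite P \<and> card P = p \<and>
     (\<forall>X\<in>P. \<forall>u\<in>X. \<forall>v\<in>X. (u, v) \<notin> parcs D)"

definition multipartite :: "nat \<Rightarrow> 'a pair_pre_digraph \<Rightarrow> bool" where
  "multipartite p D \<longleftrightarrow> (\<exists>P. multipartition D p P)"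

definition complete_multipartite :: "nat \<Rightarrow> 'a pair_pre_digraph \<Rightarrow> bool" where
  "complete_multipartite p D \<longleftrightarrow>
     (\<exists>P. multipartition D p P \<and>
        (\<forall>X\<in>P. \<forall>Y\<in>P. X \<noteq> Y \<longrightarrow>
           (\<forall>u\<in>X. \<forall>v\<in>Y. (u, v) \<in> parcs D \<or> (v, u) \<in> parcs D)))"

abbreviation bipartite :: "'a pair_pre_digraph \<Rightarrow> bool" where
  "bipartite \<equiv> multipartite 2"

abbreviation complete_bipartite :: "'a pair_pre_digraph \<Rightarrow> bool" where
  "complete_bipartite \<equiv> complete_multipartite 2"

definition matching :: "'a pair_pre_digraph \<Rightarrow> ('a \<times> 'a) set \<Rightarrow> bool" where
  "matching D M \<longleftrightarrow>
     M \<subseteq> parcs D \<and> (\<forall>e\<in>M. fst e \<noteq> snd e) \<and>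
     (\<forall>e\<in>M. \<forall>f\<in>M. e \<noteq> f \<longrightarrow> {fst e, snd e} \<inter> {fst f, snd f} = {})"

definition perfect_matching :: "'a pair_pre_digraph \<Rightarrow> ('a \<times> 'a) set \<Rightarrow> bool" where
  "perfect_matching D M \<longleftrightarrow> matching D M \<and> 2 * card M = card (pverts D)"

definition independent_set :: "'a pair_pre_digraph \<Rightarrow> 'a set \<Rightarrow> bool" where
  "independent_set D S \<longleftrightarrow> S \<subseteq> pverts D \<and> (\<forall>u\<in>S. \<forall>v\<in>S. (u, v) \<notin> parcs D)"

definition independence_number :: "'a pair_pre_digraph \<Rightarrow> nat" where
  "independence_number D = Max {card S | S. independent_set D S}"

definition chromatic_number :: "'a pair_pre_digraph \<Rightarrow> nat" where
  "chromatic_number D =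
     (LEAST k. \<exists>P. partition_on (pverts D) P \<and> finite P \<and> card P = k \<and>
                  (\<forall>X\<in>P. independent_set D X))"

text \<open>
  The library's \<^const>\<open>tree\<close> only forbids directed cycles, so it does not say that the
  underlying undirected graph is a tree. That graph is represented by \<^const>\<open>mk_symmetric\<close>,
  whose cycles of length 2 merely traverse one edge back and forth; those of length 1 are loops,
  and those of length at least 3 are the cycles of the undirected graph.
\<close>

definition underlying_tree :: "'a pair_pre_digraph \<Rightarrow> bool" where
  "underlying_tree T \<longleftrightarrow>
     connected T \<and> \<not> (\<exists>p. pre_digraph.cycle (mk_symmetric T) p \<and> length p \<noteq> 2)"

definition directed_spanning_tree ::
    "'a pair_pre_digraph \<Rightarrow> 'a \<Rightarrow> 'a pair_pre_digraph \<Rightarrow> bool" where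
  "directed_spanning_tree D r T \<longleftrightarrow>
     r \<in> pverts D \<and> spanning T D \<and> underlying_tree T \<and>
     (\<forall>v \<in> pverts D - {r}. \<exists>!p. pre_digraph.apath T r p v)"

definition dominating_set :: "'a pair_pre_digraph \<Rightarrow> 'a set \<Rightarrow> bool" where
  "dominating_set D S \<longleftrightarrow>
     S \<subseteq> pverts D \<and> (\<forall>v \<in> pverts D - S. \<exists>u\<in>S. (u, v) \<in> parcs D)"

definition domination_number :: "'a pair_pre_digraph \<Rightarrow> nat" where
  "domination_number D = (LEAST k. \<exists>S. dominating_set D S \<and> finite S \<and> card S = k)"

text \<open>
  The vertices stand for the classes of holomorphic (\<open>V1\<close>), CR (\<open>V2\<close>),
  anti-invariant (\<open>V3\<close>) and slant (\<open>V4\<close>) submanifolds of almost Hermitian manifolds.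
\<close>

datatype vertex = V1 | V2 | V3 | V4

definition D1 :: "vertex pair_pre_digraph" where
  "D1 = \<lparr> pverts = {V1, V2, V3, V4}, parcs = {(V2, V1), (V2, V3), (V4, V1), (V4, V3)} \<rparr>"

end

theory Submission
  imports Defs
begin

text \<open>
  The underlying graph is the 4-cycle, complete bipartite with sides \<open>{V1, V3}\<close> and
  \<open>{V2, V4}\<close>: an independent set lies in one side and cannot be all of the vertices, which
  gives the values of the independence and chromatic numbers. Both \<open>V2\<close> and \<open>V4\<close> are sources.
  So each dominating set contains both, and no root reaches both of them.
\<close>

lemma (in pre_digraph) cas_head_last:
  "cas u p v \<Longrightarrow> p \<noteq> [] \<Longrightarrow> head G (last p) = v"
  by (induction p arbitrary: u) (auto split: if_splits)

text \<open>A nonempty walk ends with an arc whose head is \<open>v\<close>. If no arc enters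
  \<open>v\<close>, only the empty walk remains, and it stays at its start.\<close>

lemma (in pre_digraph) awalk_source:
  assumes "awalk u p v" and "\<And>e. e \<in> arcs G \<Longrightarrow> head G e \<noteq> v"
  shows "u = v"
proof (cases "p = []")
  case False
  then have "last p \<in> arcs G" "head G (last p) = v"
    using assms(1) cas_head_last by (auto simp: awalk_def)
  then show ?thesis
    using assms(2) by blast
qed (use assms(1) in \<open>simp add: awalk_def\<close>)

lemma UNIV_vertex: "(UNIV :: vertex set) = {V1, V2, V3, V4}"
  using vertex.exhaust by blast

text \<open>Makes all sets of vertices, and all families of them, finite by type, which settles the
  finiteness premises of \<open>Max_eqI\<close> and \<open>card_mono\<close> below.\<close>

instance vertex :: finite
  by standard (simp add: UNIV_vertex)

lemma pverts_D1: "pverts D1 = UNIV"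
  by (simp add: D1_def UNIV_vertex)

lemma parcs_D1: "parcs D1 = {(V2, V1), (V2, V3), (V4, V1), (V4, V3)}"
  by (simp add: D1_def)

text \<open>The arcs are exactly the pairs from \<open>{V2, V4}\<close> to \<open>{V1, V3}\<close>,
  so a set that meets both sides contains both ends of an arc.\<close>

lemma independent_set_D1_iff:
  "independent_set D1 S \<longleftrightarrow> S \<subseteq> {V1, V3} \<or> S \<subseteq> {V2, V4}"
proof
  assume ind: "independent_set D1 S"
  show "S \<subseteq> {V1, V3} \<or> S \<subseteq> {V2, V4}"
  proof (rule ccontr)
    assume "\<not> ?thesis"
    then obtain x y where "x \<in> S" "y \<in> S" "x \<in> {V2, V4}" "y \<in> {V1, V3}"
      using UNIV_vertex by blast
    moreover from this have "(x, y) \<in> parcs D1"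
      by (auto simp: parcs_D1)
    ultimately show False
      using ind by (auto simp: independent_set_def)
  qed
qed (auto simp: independent_set_def pverts_D1 parcs_D1)

lemma partition_on_D1: "partition_on (pverts D1) {{V1, V3}, {V2, V4}}"
  by (auto simp: partition_on_def disjoint_def D1_def)

lemma card_sides: "card {{V1, V3}, {V2, V4}} = 2"
  by (simp add: doubleton_eq_iff)

lemma multipartition_D1: "multipartition D1 2 {{V1, V3}, {V2, V4}}"
  unfolding multipartition_def using partition_on_D1 card_sides by (auto simp: parcs_D1)

lemma bipartite_D1: "bipartite D1"
  using multipartition_D1 unfolding multipartite_def by blast

lemma complete_bipartite_D1: "complete_bipartite D1"
  unfolding complete_multipartite_def
  by (rule exI[of _ "{{V1, V3}, {V2, V4}}"]) (simp add: multipartition_D1 parcs_D1)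

lemma perfect_matching_D1: "perfect_matching D1 {(V2, V1), (V4, V3)}"
  by (auto simp: perfect_matching_def matching_def D1_def)

text \<open>Each side has two vertices, which bounds every independent set; \<open>{V1, V3}\<close>
  attains the bound.\<close>

lemma independence_number_D1: "independence_number D1 = 2"
  unfolding independence_number_def
proof (rule Max_eqI)
  fix k assume "k \<in> {card S | S. independent_set D1 S}"
  then obtain S where "k = card S" "S \<subseteq> {V1, V3} \<or> S \<subseteq> {V2, V4}"
    by (auto simp: independent_set_D1_iff)
  then show "k \<le> 2"
    using card_mono[of "{V1, V3}" S] card_mono[of "{V2, V4}" S] by auto
next
  show "2 \<in> {card S | S. independent_set D1 S}"
    by (auto simp: independent_set_D1_iff intro!: exI[of _ "{V1, V3}"])
qed simp

lemma chromatic_number_D1: "chromatic_number D1 = 2"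
  unfolding chromatic_number_def
proof (rule Least_equality)
  show "\<exists>P. partition_on (pverts D1) P \<and> finite P \<and> card P = 2 \<and> (\<forall>X\<in>P. independent_set D1 X)"
    using partition_on_D1 card_sides
    by (intro exI[of _ "{{V1, V3}, {V2, V4}}"]) (simp add: independent_set_D1_iff)
next
  fix k
  assume "\<exists>P. partition_on (pverts D1) P \<and> finite P \<and> card P = k \<and> (\<forall>X\<in>P. independent_set D1 X)"
  then obtain P where P: "\<Union>P = UNIV" "card P = k" "\<And>X. X \<in> P \<Longrightarrow> independent_set D1 X"
    by (auto simp: partition_on_def pverts_D1)
  \<comment> \<open>\<open>V1\<close> and \<open>V2\<close> lie on different sides, so no
    independent class contains both, and \<open>P\<close> has at least two classes.\<close>
  obtain X Y where "X \<in> P" "Y \<in> P" "V1 \<in> X" "V2 \<in> Y"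
    using P(1) by blast
  moreover from this have "X \<noteq> Y"
    using P(3) by (auto simp: independent_set_D1_iff)
  ultimately show "2 \<le> k"
    using card_mono[of P "{X, Y}"] P(2) by auto
qed

lemma no_directed_spanning_tree_D1: "\<not> directed_spanning_tree D1 r T"
proof
  assume tree: "directed_spanning_tree D1 r T"
  have reach: "r = v" if "v \<in> {V2, V4}" for v
  proof (rule ccontr)
    assume "r \<noteq> v"
    then obtain p where "pre_digraph.apath T r p v"
      using tree unfolding directed_spanning_tree_def pverts_D1 by blast
    then have "pre_digraph.awalk T r p v"
      by (simp add: pre_digraph.apath_def)
    \<comment> \<open>No arc of \<open>D1\<close> enters \<open>V2\<close> or \<open>V4\<close>. The
      inclusion carries this over to \<open>T\<close>, so that \<open>awalk_source\<close> applies
      there.\<close>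
    moreover have "parcs T \<subseteq> parcs D1"
      using tree by (auto simp: directed_spanning_tree_def spanning_def subgraph_def)
    ultimately have "r = v"
      using that by (auto intro!: pre_digraph.awalk_source simp: parcs_D1)
    with \<open>r \<noteq> v\<close> show False ..
  qed
  from reach[of V2] reach[of V4] show False by simp
qed

lemma domination_number_D1: "domination_number D1 = 2"
  unfolding domination_number_def
proof (rule Least_equality)
  show "\<exists>S. dominating_set D1 S \<and> finite S \<and> card S = 2"
    by (rule exI[of _ "{V2, V4}"]) (auto simp: dominating_set_def D1_def)
next
  fix k assume "\<exists>S. dominating_set D1 S \<and> finite S \<and> card S = k"
  then obtain S where S: "dominating_set D1 S" "card S = k"
    by blast
  \<comment> \<open>A vertex outside \<open>S\<close> must be the head of an arc, which
    \<open>V2\<close> and \<open>V4\<close> are not.\<close>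
  then have "{V2, V4} \<subseteq> S"
    by (auto simp: dominating_set_def pverts_D1 parcs_D1)
  then show "2 \<le> k"
    using card_mono[of S "{V2, V4}"] S(2) by simp
qed

theorem theorem3p1:
  shows "(bipartite D1 \<and> complete_bipartite D1) \<and>
         (\<exists>M. perfect_matching D1 M) \<and>
         independence_number D1 = 2 \<and>
         chromatic_number D1 = 2 \<and>
         \<not> (\<exists>r T. directed_spanning_tree D1 r T) \<and>
         domination_number D1 = 2"
  using bipartite_D1 complete_bipartite_D1 perfect_matching_D1 independence_number_D1
    chromatic_number_D1 no_directed_spanning_tree_D1 domination_number_D1
  by blast

end
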